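(* If the clause-set $F$ is acyclic, then $X_1(F)\in\mathcal{PC}$ (where $F$ is interpreted as an XOR-clause-set and $X_1(F)$ as a CNF-clause-set).
   Context: Literals, clauses (finite sets of literals without complementary pairs), clause-sets (finite sets of clauses); $\bot$ empty clause, $\top$ empty clause-set; $\mathrm{var}$. Partial assignments $\varphi$ and application $\varphi*F$ (delete satisfied clauses and falsified literals); a literal $x$ is forced for $F$ if $\langle x\to0\rangle*F$ is unsatisfiable. $r_1$ is unit-clause propagation; $r_\infty(F)$ is $\{\bot\}$ if $F$ is unsatisfiable, otherwise the result of applying all forced assignments. $\mathcal{PC}$ is the class of clause-sets $G$ such that for every partial assignment $\varphi$ (over any variables), $r_1(\varphi*G)=r_\infty(\varphi*G)$. Incidence graph of a family $(F_i)_{i\in I}$ of clause-sets: the bipartite graph with parts $\bigcup_i\mathrm{var}(F_i)$ and $I$, with $v$ adjacent to $i$ iff $v\in\mathrm{var}(F_i)$; the family is acyclic if this graph has no cycle. A clause-set $F$ is acyclic if the family $(\{C\})_{C\in F}$ is acyclic. XOR-clause: a clause $C$ read as $\bigoplus_{x\in C}x=0$ over $\mathbb{Z}_2$. $X_0(C)$ is the set of all clauses $D$ with $\mathrm{var}(D)=\mathrm{var}(C)$ whose number of complemented literals has parity different from that of $C$. Natural splitting of $C=\{x_1,\dots,x_n\}$: $\{C\}$ if $n\le2$; otherwise, with new distinct variables $y_2,\dots,y_{n-1}$, the XOR-clause-set $\{\{x_1,x_2,y_2\}\}\cup\{\{y_{i-1},x_i,y_i\}:3\le i\le n-1\}\cup\{\{y_{n-1},x_n\}\}$.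 $X_1(C)$ is the union of $X_0$ over the clauses of the natural splitting; $X_1(F)=\bigcup_{C\in F}X_1(C)$ with the new variables of different clauses pairwise disjoint and disjoint from $\mathrm{var}(F)$. *)

theory Defs
  imports Main
begin

section \<open>Literals, clauses, clause-sets\<close>

datatype 'v lit = Pos (lvar: 'v) | Neg (lvar: 'v)

fun compl :: "'v lit \<Rightarrow> 'v lit" where
  "compl (Pos v) = Neg v"
| "compl (Neg v) = Pos v"

fun is_compl :: "'v lit \<Rightarrow> bool" where
  "is_compl (Pos v) = False"
| "is_compl (Neg v) = True"

definition clause :: "'v lit set \<Rightarrow> bool" where
  "clause C \<longleftrightarrow> finite C \<and> (\<forall>l\<in>C. compl l \<notin> C)"

definition clause_set :: "'v lit set set \<Rightarrow> bool" where
  "clause_set F \<longleftrightarrow> finite F \<and> (\<forall>C\<in>F. clause C)"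

definition var_clause :: "'v lit set \<Rightarrow> 'v set" where
  "var_clause C = lvar ` C"

definition var :: "'v lit set set \<Rightarrow> 'v set" where
  "var F = (\<Union>C\<in>F. var_clause C)"


section \<open>Partial assignments\<close>

fun lit_val :: "('v \<rightharpoonup> bool) \<Rightarrow> 'v lit \<Rightarrow> bool option" where
  "lit_val \<phi> (Pos v) = \<phi> v"
| "lit_val \<phi> (Neg v) = map_option Not (\<phi> v)"

definition app :: "('v \<rightharpoonup> bool) \<Rightarrow> 'v lit set set \<Rightarrow> 'v lit set set" (infixr "\<star>" 75) where
  "\<phi> \<star> F = {{l \<in> C. lit_val \<phi> l \<noteq> Some False} | C. C \<in> F \<and> (\<forall>l\<in>C. lit_val \<phi> l \<noteq> Some True)}"

fun assign_lit :: "'v lit \<Rightarrow> bool \<Rightarrow> ('v \<rightharpoonup> bool)" where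
  "assign_lit (Pos v) b = [v \<mapsto> b]"
| "assign_lit (Neg v) b = [v \<mapsto> \<not> b]"

definition satisfiable :: "'v lit set set \<Rightarrow> bool" where
  "satisfiable F \<longleftrightarrow> (\<exists>\<phi>. \<phi> \<star> F = {})"

definition forced :: "'v lit set set \<Rightarrow> 'v lit \<Rightarrow> bool" where
  "forced F l \<longleftrightarrow> \<not> satisfiable (assign_lit l False \<star> F)"


section \<open>Unit-clause propagation and propagation completeness\<close>

lemma lit_val_assign:
  "lit_val (assign_lit l True) k = (if k = l then Some True else if k = compl l then Some False else None)"
  by (cases l; cases k) auto

lemma var_app_subset: "var (\<phi> \<star> F) \<subseteq> var F"
  by (auto simp: var_def var_clause_def app_def)

lemma clause_set_app:
  assumes "clause_set F"
  shows "clause_set (\<phi> \<star> F)"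
proof -
  have "\<phi> \<star> F \<subseteq> (\<lambda>C. {l \<in> C. lit_val \<phi> l \<noteq> Some False}) ` F"
    by (auto simp: app_def)
  moreover have "finite F" using assms by (simp add: clause_set_def)
  ultimately have "finite (\<phi> \<star> F)" by (meson finite_imageI finite_subset)
  moreover have "clause D" if D: "D \<in> \<phi> \<star> F" for D
  proof -
    from D obtain C where "C \<in> F" "D \<subseteq> C" unfolding app_def by blast
    with assms show ?thesis unfolding clause_set_def clause_def by (meson finite_subset subsetD)
  qed
  ultimately show ?thesis by (simp add: clause_set_def)
qed

lemma finite_var: "clause_set F \<Longrightarrow> finite (var F)"
  by (auto simp: var_def var_clause_def clause_set_def clause_def)

lemma lvar_eq_iff: "lvar k = lvar l \<longleftrightarrow> k = l \<or> k = compl l"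
  by (cases k; cases l) auto

lemma card_var_unit:
  assumes "clause_set F" "{l} \<in> F"
  shows "card (var (assign_lit l True \<star> F)) < card (var F)"
proof -
  have "lvar l \<notin> var (assign_lit l True \<star> F)"
  proof
    assume "lvar l \<in> var (assign_lit l True \<star> F)"
    then obtain C k where k: "k \<in> C" "lit_val (assign_lit l True) k \<noteq> Some False"
        "lit_val (assign_lit l True) k \<noteq> Some True" and "lvar l = lvar k"
      unfolding var_def var_clause_def app_def by blast
    then have "k = l \<or> k = compl l" by (metis lvar_eq_iff)
    with k show False by (auto simp: lit_val_assign split: if_splits)
  qed
  moreover have "lvar l \<in> var F"
    using assms(2) unfolding var_def var_clause_def by blast
  ultimately have "var (assign_lit l True \<star> F) \<subset> var F"
    using var_app_subset[of "assign_lit l True" F] by (metis psubsetI)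
  then show ?thesis
    by (rule psubset_card_mono[OF finite_var[OF assms(1)]])
qed

text \<open>
  The unit clause propagated next is picked by \<open>SOME\<close>; the result does not depend on this
  choice (lemma \<open>r1_unit\<close> below). The guard \<open>clause_set F\<close> only serves termination.
\<close>

function r1 :: "'v lit set set \<Rightarrow> 'v lit set set" where
  "r1 F =
    (if {} \<in> F then {{}}
     else if clause_set F \<and> (\<exists>l. {l} \<in> F) then r1 (assign_lit (SOME l. {l} \<in> F) True \<star> F)
     else F)"
  by pat_completeness auto
termination
  by (relation "measure (\<lambda>F. card (var F))") (auto intro: card_var_unit someI)

declare r1.simps [simp del]

lemma app_commute:
  assumes "k \<noteq> l" "k \<noteq> compl l"
  shows "assign_lit k True \<star> assign_lit l True \<star> F = assign_lit l True \<star> assign_lit k True \<star> F"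
proof -
  have *: "assign_lit k True \<star> assign_lit l True \<star> F =
      {C - {compl k, compl l} | C. C \<in> F \<and> k \<notin> C \<and> l \<notin> C}"
    if "k \<noteq> l" "k \<noteq> compl l" for k l :: "'a lit"
  proof -
    have 1: "assign_lit m True \<star> G = {C - {compl m} | C. C \<in> G \<and> m \<notin> C}" for m :: "'a lit" and G
    proof -
      have "m \<noteq> compl m" by (cases m) auto
      then have "{x \<in> C. lit_val (assign_lit m True) x \<noteq> Some False} = C - {compl m}" for C
        by (auto simp: lit_val_assign)
      moreover have "(\<forall>x\<in>C. lit_val (assign_lit m True) x \<noteq> Some True) \<longleftrightarrow> m \<notin> C" for C
        unfolding lit_val_assign by (metis option.inject option.simps(3))
      ultimately show ?thesis unfolding app_def by simp
    qed
    show ?thesis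
    proof (intro set_eqI iffI)
      fix D
      assume "D \<in> assign_lit k True \<star> assign_lit l True \<star> F"
      then obtain C where "C \<in> F" "l \<notin> C" "k \<notin> C - {compl l}" "D = C - {compl l} - {compl k}"
        unfolding 1 by blast
      then show "D \<in> {C - {compl k, compl l} | C. C \<in> F \<and> k \<notin> C \<and> l \<notin> C}"
        using that by blast
    next
      fix D
      assume "D \<in> {C - {compl k, compl l} | C. C \<in> F \<and> k \<notin> C \<and> l \<notin> C}"
      then obtain C where "C \<in> F" "l \<notin> C" "k \<notin> C" "D = C - {compl l} - {compl k}" by blast
      then show "D \<in> assign_lit k True \<star> assign_lit l True \<star> F"
        unfolding 1 by blast
    qed
  qed
  have "l \<noteq> k" "l \<noteq> compl k" using assms by (cases k; cases l; auto)+
  then show ?thesis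
    unfolding *[OF assms] *[OF \<open>l \<noteq> k\<close> \<open>l \<noteq> compl k\<close>] by blast
qed

lemma r1_unit:
  assumes "clause_set F" "{l} \<in> F" "{} \<notin> F"
  shows "r1 F = r1 (assign_lit l True \<star> F)"
  using assms
proof (induction "card (var F)" arbitrary: F l rule: less_induct)
  case less
  define k where "k = (SOME l. {l} \<in> F)"
  have k: "{k} \<in> F" unfolding k_def using less.prems(2) by (rule someI)
  have r: "r1 F = r1 (assign_lit k True \<star> F)"
    using less.prems by (subst r1.simps) (auto simp: k_def)
  have other: "{b} \<in> assign_lit a True \<star> F" if "{b} \<in> F" "b \<noteq> a" "b \<noteq> compl a" for a b
    using that by (force simp: app_def lit_val_assign)
  have empty: "{} \<in> assign_lit a True \<star> G" if "{compl a} \<in> G" for a :: "'a lit" and G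
  proof -
    have "compl a \<noteq> a" by (cases a) auto
    then show ?thesis using that by (force simp: app_def lit_val_assign)
  qed
  have confl: "r1 G = {{}}" if "{} \<in> G" for G :: "'a lit set set"
    using that by (simp add: r1.simps)
  have emptyD: "{compl a} \<in> F" if "{} \<in> assign_lit a True \<star> F" for a
  proof -
    from that obtain C where C: "C \<in> F" "{l \<in> C. lit_val (assign_lit a True) l \<noteq> Some False} = {}"
        "\<forall>l\<in>C. lit_val (assign_lit a True) l \<noteq> Some True"
      unfolding app_def by auto
    then have "C \<subseteq> {compl a}"
      by (auto simp: lit_val_assign split: if_splits)
    with C(1) less.prems(3) show ?thesis by (metis subset_singletonD)
  qed
  have cc: "compl (compl a) = a" for a :: "'a lit" by (cases a) auto
  have half: "r1 (assign_lit b True \<star> F) = {{}}"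
    if "{} \<in> assign_lit a True \<star> F" "{a} \<in> F" "{b} \<in> F" "a \<noteq> b" "a \<noteq> compl b" for a b
  proof (cases "{} \<in> assign_lit b True \<star> F")
    case False
    have "{a} \<in> assign_lit b True \<star> F" using other that by blast
    moreover have "{compl a} \<in> assign_lit b True \<star> F"
      using other[OF emptyD[OF that(1)]] that(4,5) cc by metis
    ultimately show ?thesis
      using less.hyps[OF card_var_unit[OF less.prems(1) that(3)] clause_set_app[OF less.prems(1)] _ False]
        confl[OF empty] by simp
  qed (simp add: confl)
  show ?case
  proof (cases "k = l \<or> k = compl l")
    case True
    then show ?thesis
    proof
      assume a: "k = compl l"
      then have "{} \<in> assign_lit l True \<star> F" "{} \<in> assign_lit k True \<star> F"
        using empty k less.prems(2) cc by metis+
      then show ?thesis using r confl by simp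
    qed (simp add: r)
  next
    case False
    then have ne: "k \<noteq> l" "k \<noteq> compl l" "l \<noteq> k" "l \<noteq> compl k" using cc by metis+
    show ?thesis
    proof (cases "{} \<in> assign_lit k True \<star> F \<or> {} \<in> assign_lit l True \<star> F")
      case True
      then show ?thesis
        using r half[OF _ k less.prems(2) ne(1,2)] half[OF _ less.prems(2) k ne(3,4)] confl by auto
    next
      case False
      have "r1 (assign_lit k True \<star> F) = r1 (assign_lit l True \<star> assign_lit k True \<star> F)"
        using False less.hyps[OF card_var_unit[OF less.prems(1) k] clause_set_app[OF less.prems(1)]
            other[OF less.prems(2) ne(3,4)]] by blast
      moreover have "r1 (assign_lit l True \<star> F) = r1 (assign_lit k True \<star> assign_lit l True \<star> F)"
        using False less.hyps[OF card_var_unit[OF less.prems(1) less.prems(2)]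
            clause_set_app[OF less.prems(1)] other[OF k ne(1,2)]] by blast
      ultimately show ?thesis using r app_commute[OF ne(1,2), of F] by simp
    qed
  qed
qed

definition forced_assignment :: "'v lit set set \<Rightarrow> ('v \<rightharpoonup> bool)" where
  "forced_assignment F = (\<lambda>v.
     if forced F (Pos v) then Some True
     else if forced F (Neg v) then Some False
     else None)"

definition r_inf :: "'v lit set set \<Rightarrow> 'v lit set set" where
  "r_inf F = (if satisfiable F then forced_assignment F \<star> F else {{}})"

definition PC :: "'v lit set set set" where
  "PC = {G. clause_set G \<and> (\<forall>\<phi>. r1 (\<phi> \<star> G) = r_inf (\<phi> \<star> G))}"


section \<open>Acyclicity\<close>

text \<open>A cycle of a simple undirected graph, given by its set of two-element edges.\<close>

definition cycle :: "'a set set \<Rightarrow> 'a list \<Rightarrow> bool" where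
  "cycle E p \<longleftrightarrow> length p \<ge> 3 \<and> distinct p \<and>
     (\<forall>k<length p. {p ! k, p ! (Suc k mod length p)} \<in> E)"

definition incidence_edges :: "'i set \<Rightarrow> ('i \<Rightarrow> 'v lit set set) \<Rightarrow> ('v + 'i) set set" where
  "incidence_edges I F = {{Inl v, Inr i} | v i. i \<in> I \<and> v \<in> var (F i)}"

definition acyclic_family :: "'i set \<Rightarrow> ('i \<Rightarrow> 'v lit set set) \<Rightarrow> bool" where
  "acyclic_family I F \<longleftrightarrow> (\<nexists>p. cycle (incidence_edges I F) p)"

definition acyclic_clause_set :: "'v lit set set \<Rightarrow> bool" where
  "acyclic_clause_set F \<longleftrightarrow> acyclic_family F (\<lambda>C. {C})"


section \<open>Translations of XOR-clause-sets\<close>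

definition X0 :: "'v lit set \<Rightarrow> 'v lit set set" where
  "X0 C = {D. clause D \<and> var_clause D = var_clause C \<and>
     even (card {l \<in> D. is_compl l}) \<noteq> even (card {l \<in> C. is_compl l})}"

text \<open>
  The clause is \<open>{x 1, \<dots>, x n}\<close>, enumerated without repetition; its new variables
  are \<open>y 2, \<dots>, y (n - 1)\<close> (none if \<open>n \<le> 2\<close>).
\<close>

definition natural_splitting :: "nat \<Rightarrow> (nat \<Rightarrow> 'v lit) \<Rightarrow> (nat \<Rightarrow> 'v) \<Rightarrow> 'v lit set set" where
  "natural_splitting n x y =
    (if n \<le> 2 then {x ` {1..n}}
     else {{x 1, x 2, Pos (y 2)}}
        \<union> {{Pos (y (i - 1)), x i, Pos (y i)} | i. 3 \<le> i \<and> i \<le> n - 1}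
        \<union> {{Pos (y (n - 1)), x n}})"

definition X1_clause :: "nat \<Rightarrow> (nat \<Rightarrow> 'v lit) \<Rightarrow> (nat \<Rightarrow> 'v) \<Rightarrow> 'v lit set set" where
  "X1_clause n x y = (\<Union>D\<in>natural_splitting n x y. X0 D)"

text \<open>
  \<open>X1 x y F\<close> is relative to an enumeration \<open>x C\<close> of the literals of each clause \<open>C\<close> of \<open>F\<close>
  and a family \<open>y C\<close> of new variables for it; the admissible choices are as follows.
\<close>

definition enumerates :: "('v lit set \<Rightarrow> nat \<Rightarrow> 'v lit) \<Rightarrow> 'v lit set set \<Rightarrow> bool" where
  "enumerates x F \<longleftrightarrow> (\<forall>C\<in>F. bij_betw (x C) {1..card C} C)"

definition new_vars :: "('v lit set \<Rightarrow> nat \<Rightarrow> 'v) \<Rightarrow> 'v lit set set \<Rightarrow> bool" where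
  "new_vars y F \<longleftrightarrow>
     inj_on (\<lambda>(C, i). y C i) (SIGMA C:F. {2..card C - 1}) \<and>
     (\<forall>C\<in>F. \<forall>i\<in>{2..card C - 1}. y C i \<notin> var F)"

definition X1 :: "('v lit set \<Rightarrow> nat \<Rightarrow> 'v lit) \<Rightarrow> ('v lit set \<Rightarrow> nat \<Rightarrow> 'v)
    \<Rightarrow> 'v lit set set \<Rightarrow> 'v lit set set" where
  "X1 x y F = (\<Union>C\<in>F. X1_clause (card C) (x C) (y C))"

end

theory Submission
  imports Defs
begin

text \<open>
  A clause-set \<open>G\<close> is in \<open>PC\<close> as soon as every partial assignment \<open>\<phi>\<close> for which \<open>\<phi> \<star> G\<close> has neither
  the empty clause nor a unit-clause can be extended to a total model of \<open>G\<close> making any given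
  literal true that \<open>\<phi>\<close> does not falsify. This semantic condition is preserved by the union of two
  clause-sets with at most one common variable: choose a model of the first, then a model of the
  second giving the common variable the same value, and glue. Every \<open>X0 D\<close> satisfies the condition,
  since a violated XOR-constraint is repaired by flipping one of its unassigned variables. Finally the
  natural splitting of a clause is a path of constraints, each sharing one variable with its
  predecessors, and in a finite acyclic family some member shares at most one variable with
  the union of the others.
\<close>

section \<open>Total models\<close>

fun holds :: "('v \<Rightarrow> bool) \<Rightarrow> 'v lit \<Rightarrow> bool" where
  "holds \<tau> (Pos v) = \<tau> v"
| "holds \<tau> (Neg v) = (\<not> \<tau> v)"

definition models :: "('v \<Rightarrow> bool) \<Rightarrow> 'v lit set set \<Rightarrow> bool" where
  "models \<tau> F \<longleftrightarrow> (\<forall>C\<in>F. \<exists>l\<in>C. holds \<tau> l)"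

text \<open>A model of \<open>\<phi> \<star> F\<close> may disagree with \<open>\<phi>\<close>,
  because the variables assigned by \<open>\<phi>\<close> no longer occur there. Overwriting it by
  \<open>\<phi>\<close> turns it into a model of \<open>F\<close>.\<close>

definition overrule :: "('v \<Rightarrow> bool) \<Rightarrow> ('v \<rightharpoonup> bool) \<Rightarrow> 'v \<Rightarrow> bool" where
  "overrule \<tau> \<phi> v = (case \<phi> v of None \<Rightarrow> \<tau> v | Some b \<Rightarrow> b)"

definition extends :: "('v \<Rightarrow> bool) \<Rightarrow> ('v \<rightharpoonup> bool) \<Rightarrow> bool" where
  "extends \<tau> \<phi> \<longleftrightarrow> (\<forall>v b. \<phi> v = Some b \<longrightarrow> \<tau> v = b)"

lemma holds_compl [simp]: "holds \<tau> (compl l) \<longleftrightarrow> \<not> holds \<tau> l"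
  by (cases l) auto

lemma holds_overrule:
  "holds (overrule \<tau> \<phi>) l \<longleftrightarrow> lit_val \<phi> l = Some True \<or> lit_val \<phi> l = None \<and> holds \<tau> l"
  by (cases l) (auto simp: overrule_def split: option.splits)

lemma extends_overrule: "extends (overrule \<tau> \<phi>) \<phi>"
  by (auto simp: extends_def overrule_def)

lemma overrule_extends: "extends \<tau> \<phi> \<Longrightarrow> overrule \<tau> \<phi> = \<tau>"
  by (auto simp: extends_def overrule_def fun_eq_iff split: option.splits)

lemma extends_lit_val: "extends \<tau> \<phi> \<Longrightarrow> holds \<tau> l \<Longrightarrow> lit_val \<phi> l \<noteq> Some False"
  by (cases l) (auto simp: extends_def)

lemma extends_lit_val_True: "extends \<tau> \<phi> \<Longrightarrow> lit_val \<phi> l = Some True \<Longrightarrow> holds \<tau> l"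
  by (cases l) (auto simp: extends_def)

lemma holds_cong: "\<tau> (lvar l) = \<tau>' (lvar l) \<Longrightarrow> holds \<tau> l = holds \<tau>' l"
  by (cases l) auto

lemma holds_upd_same: "holds (\<tau>(lvar l := b)) l \<longleftrightarrow> holds \<tau> l = (b = \<tau> (lvar l))"
  by (cases l) auto

lemma holds_upd_other: "lvar l \<noteq> v \<Longrightarrow> holds (\<tau>(v := b)) l = holds \<tau> l"
  by (rule holds_cong) auto

lemma models_cong:
  assumes "\<And>v. v \<in> var F \<Longrightarrow> \<tau> v = \<tau>' v"
  shows "models \<tau> F = models \<tau>' F"
proof -
  have "holds \<tau> l = holds \<tau>' l" if "C \<in> F" "l \<in> C" for C l
    using that by (intro holds_cong assms) (auto simp: var_def var_clause_def)
  then show ?thesis unfolding models_def by blast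
qed

text \<open>The clauses deleted by \<open>\<phi>\<close> are true under
  \<open>overrule \<tau> \<phi>\<close>, the deleted literals are false, and the remaining literals
  keep their value. All semantic facts about \<open>\<star>\<close> below go through this
  equivalence.\<close>

lemma models_app: "models \<tau> (\<phi> \<star> F) \<longleftrightarrow> models (overrule \<tau> \<phi>) F"
proof -
  have ex_iff: "(\<exists>l\<in>C. holds (overrule \<tau> \<phi>) l) \<longleftrightarrow>
      (\<exists>l\<in>C. lit_val \<phi> l = Some True) \<or> (\<exists>l\<in>{l \<in> C. lit_val \<phi> l \<noteq> Some False}. holds \<tau> l)" for C
  proof
    assume "(\<exists>l\<in>C. lit_val \<phi> l = Some True) \<or> (\<exists>l\<in>{l \<in> C. lit_val \<phi> l \<noteq> Some False}. holds \<tau> l)"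
    then show "\<exists>l\<in>C. holds (overrule \<tau> \<phi>) l"
    proof
      assume "\<exists>l\<in>{l \<in> C. lit_val \<phi> l \<noteq> Some False}. holds \<tau> l"
      then obtain l where l: "l \<in> C" "lit_val \<phi> l \<noteq> Some False" "holds \<tau> l" by blast
      then have "holds (overrule \<tau> \<phi>) l"
        by (cases "lit_val \<phi> l") (auto simp: holds_overrule)
      with l show ?thesis by blast
    qed (auto simp: holds_overrule)
  qed (auto simp: holds_overrule)
  have "models (overrule \<tau> \<phi>) F \<longleftrightarrow> (\<forall>C\<in>F. (\<forall>l\<in>C. lit_val \<phi> l \<noteq> Some True) \<longrightarrow>
      (\<exists>l\<in>{l \<in> C. lit_val \<phi> l \<noteq> Some False}. holds \<tau> l))"
    unfolding models_def ex_iff by (intro ball_cong refl) blast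
  also have "\<dots> \<longleftrightarrow> models \<tau> (\<phi> \<star> F)"
  proof -
    have "\<phi> \<star> F = (\<lambda>C. {l \<in> C. lit_val \<phi> l \<noteq> Some False}) ` {C \<in> F. \<forall>l\<in>C. lit_val \<phi> l \<noteq> Some True}"
      unfolding app_def by blast
    then show ?thesis by (simp add: models_def) blast
  qed
  finally show ?thesis ..
qed

lemma satisfiable_iff_models: "satisfiable F \<longleftrightarrow> (\<exists>\<tau>. models \<tau> F)"
proof
  assume "satisfiable F"
  then obtain \<phi> where "\<phi> \<star> F = {}" by (auto simp: satisfiable_def)
  then have "models (overrule (\<lambda>_. True) \<phi>) F"
    using models_app[of "\<lambda>_. True" \<phi> F] by (simp add: models_def)
  then show "\<exists>\<tau>. models \<tau> F" by blast
next
  assume "\<exists>\<tau>. models \<tau> F"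
  then obtain \<tau> where \<tau>: "models \<tau> F" ..
  have "lit_val (\<lambda>v. Some (\<tau> v)) l = Some (holds \<tau> l)" for l by (cases l) auto
  with \<tau> have "(\<lambda>v. Some (\<tau> v)) \<star> F = {}" by (auto simp: models_def app_def)
  then show "satisfiable F" by (auto simp: satisfiable_def)
qed

text \<open>\<open>holds (\<lambda>_. True) l\<close> encodes that \<open>l\<close> is positive, so
  comparing it with \<open>b\<close> gives the value assigned to the variable.\<close>

lemma overrule_assign_lit: "overrule \<tau> (assign_lit l b) = \<tau>(lvar l := (b = holds (\<lambda>_. True) l))"
  by (cases l) (auto simp: overrule_def fun_eq_iff)

lemma forced_iff_models: "forced F l \<longleftrightarrow> (\<forall>\<tau>. models \<tau> F \<longrightarrow> holds \<tau> l)"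
proof -
  have "holds (overrule \<tau> (assign_lit l False)) l = False" for \<tau>
    by (cases l) (auto simp: overrule_def fun_eq_iff)
  moreover have "overrule \<tau> (assign_lit l False) = \<tau>" if "\<not> holds \<tau> l" for \<tau>
    using that by (cases l) (auto simp: overrule_def fun_eq_iff)
  ultimately show ?thesis
    unfolding forced_def satisfiable_iff_models models_app by metis
qed

text \<open>In \<open>++\<close> the right operand wins, and \<open>\<phi>\<close> is applied first.
  This keeps iterated unit propagation in the form of one assignment applied to the original
  clause-set.\<close>

lemma app_app: "\<psi> \<star> \<phi> \<star> F = (\<psi> ++ \<phi>) \<star> F"
proof -
  have lv: "lit_val (\<psi> ++ \<phi>) l = (case lit_val \<phi> l of None \<Rightarrow> lit_val \<psi> l | Some b \<Rightarrow> Some b)" for l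
    by (cases l) (auto simp: map_add_def split: option.splits)
  have T: "(\<forall>l\<in>C. lit_val (\<psi> ++ \<phi>) l \<noteq> Some True) \<longleftrightarrow> (\<forall>l\<in>C. lit_val \<phi> l \<noteq> Some True) \<and>
      (\<forall>l\<in>{l \<in> C. lit_val \<phi> l \<noteq> Some False}. lit_val \<psi> l \<noteq> Some True)" for C
    unfolding lv by (fastforce split: option.splits)
  have D: "{l \<in> C. lit_val (\<psi> ++ \<phi>) l \<noteq> Some False} =
      {l \<in> {l \<in> C. lit_val \<phi> l \<noteq> Some False}. lit_val \<psi> l \<noteq> Some False}"
    if "\<forall>l\<in>C. lit_val \<phi> l \<noteq> Some True" for C
    using that unfolding lv by (fastforce split: option.splits)
  show ?thesis (is "?L = ?R")
  proof (intro set_eqI iffI)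
    fix E assume "E \<in> ?L"
    then obtain C where "C \<in> F" "\<forall>l\<in>C. lit_val \<phi> l \<noteq> Some True"
      "\<forall>l\<in>{l \<in> C. lit_val \<phi> l \<noteq> Some False}. lit_val \<psi> l \<noteq> Some True"
      "E = {l \<in> {l \<in> C. lit_val \<phi> l \<noteq> Some False}. lit_val \<psi> l \<noteq> Some False}"
      unfolding app_def by blast
    then have "E = {l \<in> C. lit_val (\<psi> ++ \<phi>) l \<noteq> Some False}" "C \<in> F"
      "\<forall>l\<in>C. lit_val (\<psi> ++ \<phi>) l \<noteq> Some True"
      using T[of C] D[of C] by simp_all
    then show "E \<in> ?R" unfolding app_def by blast
  next
    fix E assume "E \<in> ?R"
    then obtain C where C: "C \<in> F" "\<forall>l\<in>C. lit_val (\<psi> ++ \<phi>) l \<noteq> Some True"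
      "E = {l \<in> C. lit_val (\<psi> ++ \<phi>) l \<noteq> Some False}"
      unfolding app_def by blast
    then have "\<forall>l\<in>C. lit_val \<phi> l \<noteq> Some True"
      "\<forall>l\<in>{l \<in> C. lit_val \<phi> l \<noteq> Some False}. lit_val \<psi> l \<noteq> Some True"
      using T[of C] by blast+
    with C D[of C] show "E \<in> ?L" unfolding app_def by blast
  qed
qed

lemma empty_app [simp]: "Map.empty \<star> F = F"
proof -
  have "lit_val Map.empty l = None" for l :: "'a lit" by (cases l) auto
  then show ?thesis by (simp add: app_def)
qed

section \<open>Propagation completeness via models\<close>

text \<open>Every model of \<open>F\<close> makes \<open>l\<close> true, so setting \<open>l\<close>
  changes neither satisfiability nor which literals over other variables are forced.\<close>

lemma r_inf_unit:
  assumes "{l} \<in> F"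
  shows "r_inf (assign_lit l True \<star> F) = r_inf F"
proof -
  let ?F = "assign_lit l True \<star> F"
  have l: "holds \<tau> l" if "models \<tau> F" for \<tau>
    using that assms by (auto simp: models_def)
  have up: "holds (overrule \<tau> (assign_lit l True)) l" for \<tau>
    by (cases l) (auto simp: overrule_def fun_eq_iff)
  have same: "overrule \<tau> (assign_lit l True) = \<tau>" if "holds \<tau> l" for \<tau>
    using that by (cases l) (auto simp: overrule_def fun_eq_iff)
  have down: "models \<tau> ?F" if "models \<tau> F" for \<tau>
    using that same l by (simp add: models_app)
  have sat: "satisfiable ?F \<longleftrightarrow> satisfiable F"
    unfolding satisfiable_iff_models using down by (auto simp: models_app)
  have forced: "forced ?F k \<longleftrightarrow> forced F k" if "lvar k \<noteq> lvar l" for k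
  proof -
    have "holds (overrule \<tau> (assign_lit l True)) k = holds \<tau> k" for \<tau>
      unfolding overrule_assign_lit using that by (simp add: holds_upd_other)
    then show ?thesis
      unfolding forced_iff_models using down by (metis models_app)
  qed
  show ?thesis
  proof (cases "satisfiable F")
    case True
    then obtain \<tau> where \<tau>: "models \<tau> F" by (auto simp: satisfiable_iff_models)
    \<comment> \<open>Whatever the left operand says on \<open>lvar l\<close> is overwritten by the
      right one, which agrees there with \<open>forced_assignment F\<close> because \<open>F\<close>
      forces \<open>l\<close>.\<close>
    have "forced_assignment ?F ++ assign_lit l True = forced_assignment F"
    proof
      fix v
      show "(forced_assignment ?F ++ assign_lit l True) v = forced_assignment F v"
      proof (cases "v = lvar l")
        case True
        have "forced F l" "\<not> forced F (compl l)"
          using l \<tau> by (auto simp: forced_iff_models)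
        with True show ?thesis
          by (cases l) (auto simp: forced_assignment_def)
      next
        case False
        then have "assign_lit l True v = None" by (cases l) auto
        moreover have "forced ?F (Pos v) = forced F (Pos v)" "forced ?F (Neg v) = forced F (Neg v)"
          using forced False by auto
        ultimately show ?thesis by (simp add: map_add_def forced_assignment_def)
      qed
    qed
    then show ?thesis using True sat by (simp add: r_inf_def app_app)
  qed (simp add: r_inf_def sat)
qed

text \<open>Equivalently, \<open>\<phi> \<star> G\<close> contains neither the empty clause nor a unit-clause.\<close>

definition stable :: "('v \<rightharpoonup> bool) \<Rightarrow> 'v lit set set \<Rightarrow> bool" where
  "stable \<phi> G \<longleftrightarrow> (\<forall>C\<in>G. (\<exists>l\<in>C. lit_val \<phi> l = Some True) \<or>
     (\<exists>k\<in>C. \<exists>l\<in>C. k \<noteq> l \<and> lit_val \<phi> k = None \<and> lit_val \<phi> l = None))"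

text \<open>The literal \<open>l\<close> may be over any variable, also one outside
  \<open>var G\<close>. When two clause-sets are glued, the value of the common variable can thus be
  prescribed without asking where it occurs.\<close>

definition propagation_complete :: "'v lit set set \<Rightarrow> bool" where
  "propagation_complete G \<longleftrightarrow> (\<forall>\<phi>. stable \<phi> G \<longrightarrow>
     (\<forall>l. lit_val \<phi> l \<noteq> Some False \<longrightarrow> (\<exists>\<tau>. extends \<tau> \<phi> \<and> holds \<tau> l \<and> models \<tau> G)))"

lemma propagation_completeE:
  assumes "propagation_complete G" "stable \<phi> G" "lit_val \<phi> l \<noteq> Some False"
  obtains \<tau> where "extends \<tau> \<phi>" "holds \<tau> l" "models \<tau> G"
  using assms unfolding propagation_complete_def by blast

text \<open>What remains of a clause not satisfied by \<open>\<phi>\<close> consists of unassigned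
  literals; being neither empty nor a unit, it has two of them.\<close>

lemma stable_app:
  assumes "{} \<notin> \<phi> \<star> G" "\<nexists>l. {l} \<in> \<phi> \<star> G"
  shows "stable \<phi> G"
  unfolding stable_def
proof (intro ballI disjCI)
  fix C
  assume C: "C \<in> G"
    and two: "\<not> (\<exists>k\<in>C. \<exists>l\<in>C. k \<noteq> l \<and> lit_val \<phi> k = None \<and> lit_val \<phi> l = None)"
  show "\<exists>l\<in>C. lit_val \<phi> l = Some True"
  proof (rule ccontr)
    assume neg: "\<not> ?thesis"
    define D where "D = {l \<in> C. lit_val \<phi> l \<noteq> Some False}"
    have D: "D \<in> \<phi> \<star> G" using C neg unfolding app_def D_def by blast
    then obtain l where l: "l \<in> D" using assms(1) by (cases "D = {}") auto
    have "lit_val \<phi> k = None" if "k \<in> D" for k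
      using that neg unfolding D_def by (cases "lit_val \<phi> k") auto
    then have "D = {l}" using l two unfolding D_def by blast
    with D assms(2) show False by blast
  qed
qed

lemma not_forced_app:
  assumes "propagation_complete G" "stable \<phi> G"
  shows "\<not> forced (\<phi> \<star> G) l"
proof -
  have "\<exists>\<tau>. models \<tau> (\<phi> \<star> G) \<and> \<not> holds \<tau> l"
  proof (cases "lit_val \<phi> (compl l) = Some False")
    case False
    then obtain \<tau> where "extends \<tau> \<phi>" "holds \<tau> (compl l)" "models \<tau> G"
      using assms by (elim propagation_completeE)
    then show ?thesis by (metis models_app overrule_extends holds_compl)
  next
    \<comment> \<open>Here \<open>\<phi>\<close> already makes \<open>l\<close> true, so no model
      extending \<open>\<phi>\<close> falsifies \<open>l\<close>. But \<open>lvar l\<close> has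
      vanished from \<open>\<phi> \<star> G\<close>, whose models survive flipping it.\<close>
    case True
    then have "lit_val \<phi> l \<noteq> Some False" "lvar l \<in> dom \<phi>" by (cases l; auto)+
    from this(1) obtain \<tau> where \<tau>: "extends \<tau> \<phi>" "holds \<tau> l" "models \<tau> G"
      using assms by (elim propagation_completeE)
    let ?\<tau> = "\<tau>(lvar l := \<not> \<tau> (lvar l))"
    have "overrule ?\<tau> \<phi> = overrule \<tau> \<phi>"
      using \<open>lvar l \<in> dom \<phi>\<close> by (auto simp: overrule_def fun_eq_iff split: option.split)
    then have "models ?\<tau> (\<phi> \<star> G)" using \<tau> by (simp add: models_app overrule_extends)
    moreover have "\<not> holds ?\<tau> l" using \<tau>(2) by (simp add: holds_upd_same)
    ultimately show ?thesis by blast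
  qed
  then show ?thesis by (auto simp: forced_iff_models)
qed

text \<open>Each unit propagation preserves \<open>r_inf\<close> and removes a variable, which gives
  an induction on the number of variables. When neither the empty clause nor a unit is left, nothing
  is forced and both reductions stop.\<close>

lemma PC_if_propagation_complete:
  assumes "clause_set G" "propagation_complete G"
  shows "G \<in> PC"
proof -
  have "r1 (\<phi> \<star> G) = r_inf (\<phi> \<star> G)" for \<phi>
  proof (induction "card (var (\<phi> \<star> G))" arbitrary: \<phi> rule: less_induct)
    case less
    have cs: "clause_set (\<phi> \<star> G)" by (rule clause_set_app) fact
    consider "{} \<in> \<phi> \<star> G" | l where "{} \<notin> \<phi> \<star> G" "{l} \<in> \<phi> \<star> G"
      | "{} \<notin> \<phi> \<star> G" "\<nexists>l. {l} \<in> \<phi> \<star> G" by blast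
    then show ?case
    proof cases
      case 1
      then have "\<not> satisfiable (\<phi> \<star> G)" by (auto simp: satisfiable_iff_models models_def)
      with 1 show ?thesis by (simp add: r1.simps r_inf_def)
    next
      case 2
      then have "r1 (\<phi> \<star> G) = r1 (assign_lit l True \<star> \<phi> \<star> G)" by (intro r1_unit cs)
      also have "\<dots> = r_inf (assign_lit l True \<star> \<phi> \<star> G)"
        \<comment> \<open>\<open>app_app\<close> absorbs the unit assignment into a new partial
          assignment for \<open>G\<close>, to which the induction hypothesis applies.\<close>
        using less card_var_unit[OF cs 2(2)] by (simp add: app_app)
      also have "\<dots> = r_inf (\<phi> \<star> G)" by (rule r_inf_unit) fact
      finally show ?thesis .
    next
      case 3
      then have nf: "\<not> forced (\<phi> \<star> G) l" for l
        using not_forced_app stable_app assms(2) by blast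
      then have "satisfiable (\<phi> \<star> G)" by (auto simp: forced_iff_models satisfiable_iff_models)
      moreover have "forced_assignment (\<phi> \<star> G) = Map.empty"
        using nf by (simp add: forced_assignment_def)
      ultimately show ?thesis using 3 by (simp add: r1.simps r_inf_def)
    qed
  qed
  with assms(1) show ?thesis by (simp add: PC_def)
qed

section \<open>Gluing models along one common variable\<close>

lemma propagation_complete_empty: "propagation_complete {}"
  unfolding propagation_complete_def
proof (intro allI impI)
  fix \<phi> and l :: "'a lit"
  assume l: "lit_val \<phi> l \<noteq> Some False"
  \<comment> \<open>The default value is the sign of \<open>l\<close>, constant on all variables, so
    \<open>l\<close> is true also where \<open>\<phi>\<close> is undefined.\<close>
  have "holds (overrule (\<lambda>_. holds (\<lambda>_. True) l) \<phi>) l"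
    using l by (cases l) (auto simp: overrule_def split: option.splits)
  then show "\<exists>\<tau>. extends \<tau> \<phi> \<and> holds \<tau> l \<and> models \<tau> {}"
    using extends_overrule unfolding models_def by blast
qed

lemma models_union_glue:
  assumes pc: "propagation_complete F" "propagation_complete G"
    and s: "var F \<inter> var G \<subseteq> {s}"
    and st: "stable \<phi> F" "stable \<phi> G"
    and l: "lit_val \<phi> l \<noteq> Some False" "lvar l \<in> var F \<or> lvar l \<notin> var G"
  shows "\<exists>\<tau>. extends \<tau> \<phi> \<and> holds \<tau> l \<and> models \<tau> (F \<union> G)"
proof -
  obtain \<tau> where \<tau>: "extends \<tau> \<phi>" "holds \<tau> l" "models \<tau> F"
    using pc(1) st(1) l(1) by (rule propagation_completeE)
  \<comment> \<open>\<open>k\<close> is the literal over \<open>s\<close> that \<open>\<tau>\<close>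
    makes true; since \<open>\<tau>\<close> extends \<open>\<phi>\<close>, it may be demanded of a
    model of \<open>G\<close>.\<close>
  define k where "k = (if \<tau> s then Pos s else Neg s)"
  have "lit_val \<phi> k \<noteq> Some False"
    by (rule extends_lit_val[OF \<tau>(1)]) (simp add: k_def)
  then obtain \<sigma> where \<sigma>: "extends \<sigma> \<phi>" "holds \<sigma> k" "models \<sigma> G"
    using pc(2) st(2) by (elim propagation_completeE)
  have eq: "\<sigma> s = \<tau> s" using \<sigma>(2) by (simp add: k_def split: if_splits)
  \<comment> \<open>On \<open>var F\<close> this differs from \<open>\<tau>\<close> at most at
    \<open>s\<close>, where both models agree. The condition on \<open>lvar l\<close> ensures that
    \<open>l\<close> keeps its value.\<close>
  define \<rho> where "\<rho> v = (if v \<in> var G then \<sigma> v else \<tau> v)" for v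
  have F: "\<rho> v = \<tau> v" if "v \<in> var F" for v
    using that s eq by (auto simp: \<rho>_def)
  have "models \<rho> F" using models_cong[of F \<rho> \<tau>] F \<tau>(3) by simp
  moreover have "models \<rho> G" using models_cong[of G \<rho> \<sigma>] \<sigma>(3) by (simp add: \<rho>_def)
  moreover have "extends \<rho> \<phi>" using \<tau>(1) \<sigma>(1) by (simp add: extends_def \<rho>_def)
  moreover have "holds \<rho> l"
    using holds_cong[of \<rho> l \<tau>] l(2) F \<tau>(2) by (auto simp: \<rho>_def)
  ultimately show ?thesis by (auto simp: models_def)
qed

lemma propagation_complete_Un:
  assumes "propagation_complete F" "propagation_complete G" "var F \<inter> var G \<subseteq> {s}"
  shows "propagation_complete (F \<union> G)"
  unfolding propagation_complete_def
proof (intro allI impI)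
  fix \<phi> l
  assume "stable \<phi> (F \<union> G)" and l: "lit_val \<phi> l \<noteq> Some False"
  then have st: "stable \<phi> F" "stable \<phi> G" by (auto simp: stable_def)
  show "\<exists>\<tau>. extends \<tau> \<phi> \<and> holds \<tau> l \<and> models \<tau> (F \<union> G)"
  proof (cases "lvar l \<in> var F \<or> lvar l \<notin> var G")
    case True
    with assms st l show ?thesis by (intro models_union_glue)
  next
    \<comment> \<open>Now \<open>lvar l\<close> occurs only in \<open>G\<close>, so the model of
      \<open>G\<close> is chosen first.\<close>
    case False
    then show ?thesis
      using models_union_glue[of G F s \<phi> l] assms st l by (auto simp: Un_commute Int_commute)
  qed
qed

section \<open>XOR-clauses and their natural splitting\<close>

text \<open>A falsified clause is determined by its variables and \<open>\<tau>\<close>. The parity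
  of its complemented literals is thus the parity of the number of its variables that are true under
  \<open>\<tau>\<close>.\<close>

lemma compl_literals_of_falsified:
  assumes "\<forall>l\<in>E. \<not> holds \<tau> l"
  shows "{l \<in> E. is_compl l} = Neg ` {v \<in> var_clause E. \<tau> v}"
proof (intro set_eqI iffI)
  fix l assume "l \<in> {l \<in> E. is_compl l}"
  with assms show "l \<in> Neg ` {v \<in> var_clause E. \<tau> v}"
    by (cases l) (force simp: var_clause_def)+
next
  fix l assume "l \<in> Neg ` {v \<in> var_clause E. \<tau> v}"
  then obtain k where "k \<in> E" "l = Neg (lvar k)" "\<tau> (lvar k)" by (auto simp: var_clause_def)
  with assms show "l \<in> {l \<in> E. is_compl l}" by (cases k) auto
qed

text \<open>Clauses of \<open>X0 D\<close> falsified before and after the flip would have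
  complemented literals of the same parity, whereas the number of true variables changes by exactly
  one.\<close>

lemma models_X0_flip:
  assumes "E \<in> X0 D" "\<forall>l\<in>E. \<not> holds \<tau> l" "u \<in> var_clause D"
  shows "models (\<tau>(u := \<not> \<tau> u)) (X0 D)"
proof (rule ccontr)
  let ?\<tau> = "\<tau>(u := \<not> \<tau> u)"
  assume "\<not> ?thesis"
  then obtain E' where E': "E' \<in> X0 D" "\<forall>l\<in>E'. \<not> holds ?\<tau> l"
    unfolding models_def by blast
  have fin: "finite (var_clause D)"
    using assms(1) unfolding X0_def clause_def by (metis (mono_tags, lifting) finite_imageI mem_Collect_eq var_clause_def)
  define A where "A = {v \<in> var_clause D. \<tau> v}"
  define B where "B = {v \<in> var_clause D. ?\<tau> v}"
  have D: "var_clause E = var_clause D" "var_clause E' = var_clause D"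
    "even (card {l \<in> E. is_compl l}) = even (card {l \<in> E'. is_compl l})"
    using E'(1) assms(1) by (auto simp: X0_def)
  have "even (card (Neg ` A)) = even (card (Neg ` B))"
    using D(3) unfolding compl_literals_of_falsified[OF assms(2)] compl_literals_of_falsified[OF E'(2)]
      D(1,2) A_def B_def .
  moreover have "card (Neg ` S) = card S" for S :: "'a set" by (rule card_image) (simp add: inj_on_def)
  ultimately have par: "even (card A) = even (card B)" by simp
  have fin': "finite A" "finite B" using fin by (simp_all add: A_def B_def)
  have "A = insert u B \<and> u \<notin> B \<or> B = insert u A \<and> u \<notin> A"
    using assms(3) by (cases "\<tau> u") (auto simp: A_def B_def)
  with fin' have "card A = Suc (card B) \<or> card B = Suc (card A)"
    by (elim disjE conjE) simp_all
  with par show False by auto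
qed

lemma propagation_complete_X0: "propagation_complete (X0 D)"
  unfolding propagation_complete_def
proof (intro allI impI)
  fix \<phi> l
  assume st: "stable \<phi> (X0 D)" and l: "lit_val \<phi> l \<noteq> Some False"
  \<comment> \<open>The empty clause-set supplies an extension of \<open>\<phi>\<close> satisfying
    \<open>l\<close>, with no regard yet for \<open>X0 D\<close>.\<close>
  obtain \<tau> where \<tau>: "extends \<tau> \<phi>" "holds \<tau> l"
    using propagation_complete_empty _ l by (rule propagation_completeE) (simp add: stable_def)
  show "\<exists>\<tau>. extends \<tau> \<phi> \<and> holds \<tau> l \<and> models \<tau> (X0 D)"
  proof (cases "models \<tau> (X0 D)")
    case False
    then obtain E where E: "E \<in> X0 D" "\<forall>l\<in>E. \<not> holds \<tau> l" unfolding models_def by blast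
    then have "\<nexists>k. k \<in> E \<and> lit_val \<phi> k = Some True"
      using extends_lit_val_True[OF \<tau>(1)] by blast
    then obtain a b where ab: "a \<in> E" "b \<in> E" "a \<noteq> b" "lit_val \<phi> a = None" "lit_val \<phi> b = None"
      using st E(1) unfolding stable_def by blast
    have "lvar a \<noteq> lvar b"
      using E(1) ab(1-3) unfolding X0_def clause_def lvar_eq_iff by auto
    \<comment> \<open>Of two unassigned variables at least one differs from \<open>lvar l\<close>;
      flipping it affects neither \<open>\<phi>\<close> nor \<open>l\<close>.\<close>
    then obtain k where k: "k \<in> E" "lit_val \<phi> k = None" "lvar k \<noteq> lvar l"
      using ab by metis
    let ?\<tau> = "\<tau>(lvar k := \<not> \<tau> (lvar k))"
    have "lvar k \<in> var_clause D" using E(1) k(1) by (auto simp: X0_def var_clause_def)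
    then have "models ?\<tau> (X0 D)" by (rule models_X0_flip[OF E])
    moreover have "\<phi> (lvar k) = None" using k(2) by (cases k) auto
    then have "extends ?\<tau> \<phi>" using \<tau>(1) by (auto simp: extends_def)
    moreover have "holds ?\<tau> l" using \<tau>(2) k(3) by (simp add: holds_upd_other)
    ultimately show ?thesis by blast
  qed (use \<tau> in blast)
qed

section \<open>Variables of the translations, and the natural splitting as a path\<close>

lemma var_X0_subset: "var (X0 D) \<subseteq> var_clause D"
  by (auto simp: var_def X0_def)

lemma var_Un: "var (F \<union> G) = var F \<union> var G"
  by (auto simp: var_def)

lemma var_UN: "var (\<Union>i\<in>I. F i) = (\<Union>i\<in>I. var (F i))"
  by (auto simp: var_def)

lemma finite_X0:
  assumes "finite D"
  shows "finite (X0 D)"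
proof (rule finite_subset)
  show "X0 D \<subseteq> Pow (Pos ` var_clause D \<union> Neg ` var_clause D)"
  proof (intro subsetI PowI)
    fix E l assume "E \<in> X0 D" "l \<in> E"
    then have "lvar l \<in> var_clause D" by (auto simp: X0_def var_clause_def)
    then show "l \<in> Pos ` var_clause D \<union> Neg ` var_clause D" by (cases l) auto
  qed
  show "finite (Pow (Pos ` var_clause D \<union> Neg ` var_clause D))"
    using assms by (simp add: var_clause_def)
qed

text \<open>For \<open>2 \<le> m\<close> this translates the first \<open>m - 1\<close> constraints
  of the path, without the closing binary one; for \<open>m = 2\<close> the union over
  \<open>{3..m}\<close> is empty. The path grows by induction on \<open>m\<close>.\<close>

definition split_prefix :: "nat \<Rightarrow> (nat \<Rightarrow> 'v lit) \<Rightarrow> (nat \<Rightarrow> 'v) \<Rightarrow> 'v lit set set" where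
  "split_prefix m x y =
     X0 {x 1, x 2, Pos (y 2)} \<union> (\<Union>i\<in>{3..m}. X0 {Pos (y (i - 1)), x i, Pos (y i)})"

lemma split_prefix_Suc:
  "2 \<le> m \<Longrightarrow> split_prefix (Suc m) x y = split_prefix m x y \<union> X0 {Pos (y m), x (Suc m), Pos (y (Suc m))}"
  by (auto simp: split_prefix_def atLeastAtMostSuc_conv)

lemma X1_clause_eq:
  "X1_clause n x y = (if n \<le> 2 then X0 (x ` {1..n})
     else split_prefix (n - 1) x y \<union> X0 {Pos (y (n - 1)), x n})"
proof -
  have "{{Pos (y (i - 1)), x i, Pos (y i)} | i. 3 \<le> i \<and> i \<le> n - 1} =
      (\<lambda>i. {Pos (y (i - 1)), x i, Pos (y i)}) ` {3..n - 1}"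
    by auto
  then show ?thesis by (simp add: X1_clause_def natural_splitting_def split_prefix_def Un_ac)
qed

lemma var_split_prefix:
  assumes "2 \<le> m"
  shows "var (split_prefix m x y) \<subseteq> lvar ` x ` {1..m} \<union> y ` {2..m}"
proof -
  have 1: "var_clause {x 1, x 2, Pos (y 2)} \<subseteq> lvar ` x ` {1..m} \<union> y ` {2..m}"
    using assms by (auto simp: var_clause_def)
  have 2: "var_clause {Pos (y (i - 1)), x i, Pos (y i)} \<subseteq> lvar ` x ` {1..m} \<union> y ` {2..m}"
    if "i \<in> {3..m}" for i
  proof -
    have "i - 1 \<in> {2..m}" "i \<in> {2..m}" "i \<in> {1..m}" using that by auto
    then have "y (i - 1) \<in> y ` {2..m}" "y i \<in> y ` {2..m}" "lvar (x i) \<in> lvar ` x ` {1..m}"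
      by (simp_all only: imageI)
    then show ?thesis by (simp add: var_clause_def)
  qed
  show ?thesis
    unfolding split_prefix_def var_Un var_UN
    by (intro Un_least UN_least order_trans[OF var_X0_subset] 1 2)
qed

lemma var_X1_clause: "var (X1_clause n x y) \<subseteq> lvar ` x ` {1..n} \<union> y ` {2..n - 1}"
proof (cases "n \<le> 2")
  case True
  then show ?thesis
    using var_X0_subset[of "x ` {1..n}"] by (auto simp: X1_clause_eq var_clause_def)
next
  case False
  have 1: "var_clause {Pos (y (n - 1)), x n} \<subseteq> lvar ` x ` {1..n} \<union> y ` {2..n - 1}"
    using False by (auto simp: var_clause_def)
  have 2: "var (split_prefix (n - 1) x y) \<subseteq> lvar ` x ` {1..n - 1} \<union> y ` {2..n - 1}"
    using False by (intro var_split_prefix) auto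
  have 3: "lvar ` x ` {1..n - 1} \<union> y ` {2..n - 1} \<subseteq> lvar ` x ` {1..n} \<union> y ` {2..n - 1}"
    by (intro Un_mono image_mono) auto
  have "var (split_prefix (n - 1) x y \<union> X0 {Pos (y (n - 1)), x n}) \<subseteq> lvar ` x ` {1..n} \<union> y ` {2..n - 1}"
    unfolding var_Un by (rule Un_least[OF order_trans[OF 2 3] order_trans[OF var_X0_subset 1]])
  with False show ?thesis by (simp add: X1_clause_eq)
qed

lemma clause_set_X1_clause: "clause_set (X1_clause n x y)"
proof -
  have "finite (X1_clause n x y)"
    by (simp add: X1_clause_eq split_prefix_def finite_X0)
  moreover have "clause D" if "D \<in> X1_clause n x y" for D
    using that by (auto simp: X1_clause_def X0_def)
  ultimately show ?thesis by (simp add: clause_set_def)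
qed

text \<open>The constraint appended to the prefix of index \<open>m\<close> brings fresh variables
  \<open>x (Suc m)\<close> and \<open>y (Suc m)\<close>, so it meets the prefix at most in
  \<open>y m\<close> and gluing applies.\<close>

lemma propagation_complete_X1_clause:
  assumes x: "inj_on (\<lambda>i. lvar (x i)) {1..n}" and y: "inj_on y {2..n - 1}"
    and xy: "\<And>i j. i \<in> {1..n} \<Longrightarrow> j \<in> {2..n - 1} \<Longrightarrow> lvar (x i) \<noteq> y j"
  shows "propagation_complete (X1_clause n x y)"
proof (cases "n \<le> 2")
  case True
  then show ?thesis by (simp add: X1_clause_eq propagation_complete_X0)
next
  case False
  have x': "lvar (x i) \<noteq> lvar (x j)" if "i \<in> {1..n}" "j \<in> {1..n}" "i \<noteq> j" for i j
    using inj_onD[OF x] that by blast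
  have y': "y i \<noteq> y j" if "i \<in> {2..n - 1}" "j \<in> {2..n - 1}" "i \<noteq> j" for i j
    using inj_onD[OF y] that by blast
  have xf: "lvar (x (Suc m)) \<notin> lvar ` x ` {1..m} \<union> y ` {2..m}" if "Suc m \<le> n" for m
  proof
    assume "lvar (x (Suc m)) \<in> lvar ` x ` {1..m} \<union> y ` {2..m}"
    then consider i where "i \<in> {1..m}" "lvar (x (Suc m)) = lvar (x i)"
      | j where "j \<in> {2..m}" "lvar (x (Suc m)) = y j" by auto
    then show False
    proof cases
      case (1 i)
      then show False using that x'[of "Suc m" i] by auto
    next
      case (2 j)
      then have "Suc m \<in> {1..n}" "j \<in> {2..n - 1}" using that by auto
      from xy[OF this] 2(2) show False by simp
    qed
  qed
  have yf: "y (Suc m) \<notin> lvar ` x ` {1..m} \<union> y ` {2..m}" if "2 \<le> m" "Suc m \<le> n - 1" for m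
  proof
    assume "y (Suc m) \<in> lvar ` x ` {1..m} \<union> y ` {2..m}"
    then consider i where "i \<in> {1..m}" "y (Suc m) = lvar (x i)"
      | j where "j \<in> {2..m}" "y (Suc m) = y j" by auto
    then show False
    proof cases
      case (1 i)
      then have "i \<in> {1..n}" "Suc m \<in> {2..n - 1}" using that by auto
      from xy[OF this] 1(2) show False by simp
    next
      case (2 j)
      then show False using that y'[of "Suc m" j] by auto
    qed
  qed
  have pre: "propagation_complete (split_prefix m x y)" if "2 \<le> m" "m \<le> n - 1" for m
    using that
  proof (induction m rule: dec_induct)
    case base
    then show ?case by (simp add: split_prefix_def propagation_complete_X0)
  next
    case (step m)
    have "Suc m \<le> n" "Suc m \<le> n - 1" using step by auto
    with xf[of m] yf[of m] var_split_prefix[OF step(1), of x y] step(1)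
    have "lvar (x (Suc m)) \<notin> var (split_prefix m x y)" "y (Suc m) \<notin> var (split_prefix m x y)"
      by (meson subsetD)+
    then have "var (split_prefix m x y) \<inter> var (X0 {Pos (y m), x (Suc m), Pos (y (Suc m))}) \<subseteq> {y m}"
      using var_X0_subset[of "{Pos (y m), x (Suc m), Pos (y (Suc m))}"]
      by (auto simp: var_clause_def)
    moreover have "propagation_complete (split_prefix m x y)" using step by simp
    ultimately show ?case
      unfolding split_prefix_Suc[OF step(1)]
      by (intro propagation_complete_Un[where s = "y m"] propagation_complete_X0)
  qed
  have n: "Suc (n - 1) = n" "2 \<le> n - 1" using False by auto
  \<comment> \<open>The closing constraint adds only \<open>x n\<close> and is attached at
    \<open>y (n - 1)\<close>.\<close>
  have "lvar (x n) \<notin> var (split_prefix (n - 1) x y)"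
    using var_split_prefix[OF n(2), of x y] xf[of "n - 1"] unfolding n(1) by blast
  then have "var (split_prefix (n - 1) x y) \<inter> var (X0 {Pos (y (n - 1)), x n}) \<subseteq> {y (n - 1)}"
    using var_X0_subset[of "{Pos (y (n - 1)), x n}"] by (auto simp: var_clause_def)
  then have "propagation_complete (split_prefix (n - 1) x y \<union> X0 {Pos (y (n - 1)), x n})"
    by (intro propagation_complete_Un[where s = "y (n - 1)"] pre propagation_complete_X0) (use n in auto)
  with False show ?thesis by (simp add: X1_clause_eq)
qed

section \<open>Acyclic families\<close>

text \<open>A longest simple path inside \<open>W\<close> cannot be extended at its first vertex, so
  all neighbours of that vertex in \<open>W\<close> lie on the path, and one of them closes a
  cycle.\<close>

lemma cycle_in_min_degree_two:
  assumes fin: "finite W" and ne: "W \<noteq> {}" and loop: "\<And>w. {w} \<notin> E"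
    and deg: "\<And>w. w \<in> W \<Longrightarrow> \<exists>a\<in>W. \<exists>b\<in>W. a \<noteq> b \<and> {w, a} \<in> E \<and> {w, b} \<in> E"
  shows "\<exists>p. cycle E p"
proof -
  define P where "P p \<longleftrightarrow> p \<noteq> [] \<and> distinct p \<and> set p \<subseteq> W \<and>
      (\<forall>k. Suc k < length p \<longrightarrow> {p ! k, p ! Suc k} \<in> E)" for p
  obtain w where "w \<in> W" using ne by blast
  then have "P [w]" by (simp add: P_def)
  moreover have "length p < Suc (card W)" if "P p" for p
    using that card_mono[OF fin, of "set p"] by (simp add: P_def distinct_card)
  \<comment> \<open>A longest path exists because a path without repetition in \<open>W\<close> has
    at most \<open>card W\<close> vertices.\<close>
  ultimately obtain p where p: "P p" and max: "\<And>q. P q \<Longrightarrow> length q \<le> length p"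
    using ex_has_greatest_nat[of P "[w]" length "Suc (card W)"] by (metis less_or_eq_imp_le)
  then obtain h t where ht: "p = h # t" by (cases p) (auto simp: P_def)
  have in_p: "a \<in> set p" if "a \<in> W" "{h, a} \<in> E" for a
  proof (rule ccontr)
    assume "a \<notin> set p"
    moreover have "{(a # p) ! k, (a # p) ! Suc k} \<in> E" if "Suc k < length (a # p)" for k
      using that p \<open>{h, a} \<in> E\<close> by (cases k) (auto simp: P_def ht insert_commute)
    ultimately have "P (a # p)" using p that(1) by (auto simp: P_def)
    then show False using max by fastforce
  qed
  have "h \<in> W" using p by (simp add: P_def ht)
  then obtain a b where ab: "a \<in> W" "b \<in> W" "a \<noteq> b" "{h, a} \<in> E" "{h, b} \<in> E"
    using deg by blast
  obtain i j where ij: "i < length p" "p ! i = a" "j < length p" "p ! j = b"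
    using in_p ab by (metis in_set_conv_nth)
  have "i \<noteq> 0" "j \<noteq> 0" "i \<noteq> j"
    using ij ab loop[of h] by (auto simp: ht intro: gr0I)
  \<comment> \<open>Two different nonzero positions cannot both be 1. Position at least 2 gives the
    cycle its required three vertices.\<close>
  then obtain k where k: "2 \<le> k" "k < length p" "{h, p ! k} \<in> E"
    using ij ab by (metis One_nat_def Suc_1 Suc_leI le_neq_implies_less neq0_conv)
  let ?q = "take (Suc k) p"
  have len: "length ?q = Suc k" using k by simp
  have "{?q ! m, ?q ! (Suc m mod length ?q)} \<in> E" if "m < length ?q" for m
  proof (cases "m = k")
    case True
    then show ?thesis using k ht by (simp only: len mod_self) (simp add: insert_commute)
  next
    case False
    then have "Suc m < Suc k" using that len by simp
    then show ?thesis using p k by (simp add: len P_def del: length_take)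
  qed
  then have "cycle E ?q" using p k len by (simp add: cycle_def P_def)
  then show ?thesis ..
qed

lemma acyclic_family_subset:
  assumes "acyclic_family J F" "I \<subseteq> J"
  shows "acyclic_family I F"
proof -
  have "incidence_edges I F \<subseteq> incidence_edges J F"
    using assms(2) by (auto simp: incidence_edges_def)
  then have "cycle (incidence_edges J F) p" if "cycle (incidence_edges I F) p" for p
    using that unfolding cycle_def by (meson subsetD)
  with assms(1) show ?thesis by (auto simp: acyclic_family_def)
qed

lemma incidence_edge_iff:
  "{Inl v, Inr i} \<in> incidence_edges I F \<longleftrightarrow> i \<in> I \<and> v \<in> var (F i)"
  by (auto simp: incidence_edges_def doubleton_eq_iff)

text \<open>If every member shared two variables with the others, the members together with the
  shared variables would induce a subgraph of minimum degree two, hence contain a cycle.\<close>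

lemma acyclic_family_leaf:
  assumes fin: "finite I" "\<And>i. i \<in> I \<Longrightarrow> finite (var (F i))" and ne: "I \<noteq> {}"
    and acyc: "acyclic_family I F"
  shows "\<exists>i\<in>I. \<exists>s. var (F i) \<inter> var (\<Union>j\<in>I - {i}. F j) \<subseteq> {s}"
proof (rule ccontr)
  assume neg: "\<not> ?thesis"
  let ?E = "incidence_edges I F"
  \<comment> \<open>Variables of a single member are left out, since they have degree one in the
    incidence graph.\<close>
  define S where "S = {v. \<exists>i\<in>I. \<exists>j\<in>I. i \<noteq> j \<and> v \<in> var (F i) \<and> v \<in> var (F j)}"
  define W where "W = Inl ` S \<union> Inr ` I"
  have "S \<subseteq> (\<Union>i\<in>I. var (F i))" by (auto simp: S_def)
  then have "finite S" using fin by (meson finite_UN_I finite_subset)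
  then have "finite W" using fin by (simp add: W_def)
  moreover have "W \<noteq> {}" using ne by (simp add: W_def)
  moreover have "{w} \<notin> ?E" for w
    by (auto simp: incidence_edges_def)
  moreover have "\<exists>a\<in>W. \<exists>b\<in>W. a \<noteq> b \<and> {w, a} \<in> ?E \<and> {w, b} \<in> ?E" if w: "w \<in> W" for w
  proof (cases w)
    case (Inl v)
    then have "v \<in> S" using w by (auto simp: W_def)
    then obtain i j where "i \<in> I" "j \<in> I" "i \<noteq> j" "v \<in> var (F i)" "v \<in> var (F j)"
      by (auto simp: S_def)
    then show ?thesis
      by (intro bexI[of _ "Inr i"] bexI[of _ "Inr j"]) (auto simp: Inl incidence_edge_iff W_def)
  next
    case (Inr i)
    then have i: "i \<in> I" using w by (auto simp: W_def)
    let ?V = "var (F i) \<inter> var (\<Union>j\<in>I - {i}. F j)"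
    have "?V \<subseteq> S" using i by (auto simp: S_def var_UN)
    moreover have "\<not> ?V \<subseteq> {s}" for s using neg i by blast
    then obtain u v where "u \<in> ?V" "v \<in> ?V" "u \<noteq> v" by blast
    ultimately have "Inl u \<in> W" "Inl v \<in> W" "u \<noteq> v" "u \<in> var (F i)" "v \<in> var (F i)"
      by (auto simp: W_def)
    then show ?thesis using i
      by (intro bexI[of _ "Inl u"] bexI[of _ "Inl v"])
        (auto simp: Inr incidence_edge_iff insert_commute[of "Inr i"])
  qed
  ultimately have "\<exists>p. cycle ?E p" by (rule cycle_in_min_degree_two)
  with acyc show False by (simp add: acyclic_family_def)
qed

text \<open>Removing a member that shares at most one variable with the rest leaves a smaller
  acyclic family, and gluing adds the member back.\<close>

lemma propagation_complete_acyclic_family: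
  assumes "finite I" "\<And>i. i \<in> I \<Longrightarrow> finite (var (F i))" "acyclic_family I F"
    and "\<And>i. i \<in> I \<Longrightarrow> propagation_complete (F i)"
  shows "propagation_complete (\<Union>i\<in>I. F i)"
  using assms
proof (induction I rule: finite_psubset_induct)
  case (psubset I)
  show ?case
  proof (cases "I = {}")
    case True
    then show ?thesis by (simp add: propagation_complete_empty)
  next
    case False
    then obtain i s where i: "i \<in> I" "var (F i) \<inter> var (\<Union>j\<in>I - {i}. F j) \<subseteq> {s}"
      using acyclic_family_leaf[OF psubset.hyps psubset.prems(1) _ psubset.prems(2)] by blast
    have "propagation_complete (\<Union>j\<in>I - {i}. F j)"
      using i(1) psubset.prems acyclic_family_subset[OF psubset.prems(2)]
      by (intro psubset.IH) auto
    then have "propagation_complete (F i \<union> (\<Union>j\<in>I - {i}. F j))"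
      using psubset.prems(3) i by (intro propagation_complete_Un)
    also have "F i \<union> (\<Union>j\<in>I - {i}. F j) = (\<Union>i\<in>I. F i)" using i(1) by blast
    finally show ?thesis .
  qed
qed

section \<open>Cycles under a change of the members' variables\<close>

lemma cycle_neighbours:
  assumes "cycle E p" "w \<in> set p"
  obtains a b where "a \<in> set p" "b \<in> set p" "a \<noteq> b" "{w, a} \<in> E" "{w, b} \<in> E"
proof -
  obtain k where k: "k < length p" "p ! k = w" using assms(2) by (metis in_set_conv_nth)
  let ?n = "length p"
  have n: "?n \<ge> 3" and dist: "distinct p" and E: "\<And>k. k < ?n \<Longrightarrow> {p ! k, p ! (Suc k mod ?n)} \<in> E"
    using assms(1) by (auto simp: cycle_def)
  \<comment> \<open>The cyclic predecessor of \<open>k\<close>; it differs from the successor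
    because a cycle has at least three vertices.\<close>
  define j where "j = (if k = 0 then ?n - 1 else k - 1)"
  have j: "j < ?n" "Suc j mod ?n = k" using k n by (auto simp: j_def)
  have s: "Suc k mod ?n < ?n" using n by (intro mod_less_divisor) linarith
  have "j \<noteq> Suc k mod ?n"
    using k n by (cases "Suc k = ?n") (auto simp: j_def)
  then have "p ! j \<noteq> p ! (Suc k mod ?n)"
    using dist j s by (simp add: nth_eq_iff_index_eq)
  moreover have "{w, p ! j} \<in> E" using E[OF j(1)] j k by (simp add: insert_commute)
  moreover have "{w, p ! (Suc k mod ?n)} \<in> E" using E[OF k(1)] k by simp
  ultimately show ?thesis using that j s nth_mem by blast
qed

text \<open>A variable occurring in only one member has a single neighbour, hence lies on no cycle.\<close>

lemma acyclic_family_private_vars: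
  assumes acyc: "acyclic_family I F"
    and priv: "\<And>i j v. \<lbrakk>i \<in> I; j \<in> I; i \<noteq> j; v \<in> var (G i); v \<in> var (G j)\<rbrakk> \<Longrightarrow> v \<in> var (F i)"
  shows "acyclic_family I G"
  unfolding acyclic_family_def
proof
  assume "\<exists>p. cycle (incidence_edges I G) p"
  then obtain p where p: "cycle (incidence_edges I G) p" ..
  have old: "v \<in> var (F i)" if v: "Inl v \<in> set p" "i \<in> I" "v \<in> var (G i)" for v i
  proof -
    obtain a b where ab: "a \<noteq> b" "{Inl v, a} \<in> incidence_edges I G" "{Inl v, b} \<in> incidence_edges I G"
      using cycle_neighbours[OF p v(1)] by metis
    then obtain j k where "j \<in> I" "k \<in> I" "j \<noteq> k" "v \<in> var (G j)" "v \<in> var (G k)"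
      by (auto simp: incidence_edges_def doubleton_eq_iff)
    \<comment> \<open>At least one of \<open>j\<close> and \<open>k\<close> differs from
      \<open>i\<close>, so \<open>v\<close> is common to \<open>i\<close> and another
      member.\<close>
    then show ?thesis using priv[of i] v by metis
  qed
  have "cycle (incidence_edges I F) p"
    unfolding cycle_def
  proof (intro conjI allI impI)
    fix k assume k: "k < length p"
    let ?e = "{p ! k, p ! (Suc k mod length p)}"
    have "?e \<in> incidence_edges I G" using p k by (simp add: cycle_def)
    then obtain v i where e: "?e = {Inl v, Inr i}" "i \<in> I" "v \<in> var (G i)"
      by (auto simp: incidence_edges_def)
    have "Suc k mod length p < length p" using k by (intro mod_less_divisor) linarith
    then have "?e \<subseteq> set p" using k by simp
    then have "Inl v \<in> set p" using e(1) by simp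
    then show "?e \<in> incidence_edges I F" using e old by (simp add: incidence_edge_iff)
  qed (use p in \<open>simp_all add: cycle_def\<close>)
  with acyc show False by (auto simp: acyclic_family_def)
qed

theorem theorem8p5:
  fixes F :: "'v lit set set"
    and x :: "'v lit set \<Rightarrow> nat \<Rightarrow> 'v lit"
    and y :: "'v lit set \<Rightarrow> nat \<Rightarrow> 'v"
  assumes "clause_set F"
    and "acyclic_clause_set F"
    and "enumerates x F"
    and "new_vars y F"
  shows "X1 x y F \<in> PC"
proof -
  define G where "G C = X1_clause (card C) (x C) (y C)" for C
  have X1: "X1 x y F = (\<Union>C\<in>F. G C)" by (simp add: X1_def G_def)
  have fin: "finite F" using assms(1) by (simp add: clause_set_def)
  have G: "clause_set (G C)" for C by (simp add: G_def clause_set_X1_clause)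
  have bij: "bij_betw (x C) {1..card C} C" if "C \<in> F" for C
    using assms(3) that by (simp add: enumerates_def)
  have y_inj: "C = D \<and> i = j"
    if "C \<in> F" "D \<in> F" "i \<in> {2..card C - 1}" "j \<in> {2..card D - 1}" "y C i = y D j" for C D i j
  proof -
    have "inj_on (\<lambda>(C, i). y C i) (SIGMA C:F. {2..card C - 1})"
      using assms(4) by (simp add: new_vars_def)
    from inj_onD[OF this, of "(C, i)" "(D, j)"] that show ?thesis by simp
  qed
  have y_new: "y C i \<notin> var F" if "C \<in> F" "i \<in> {2..card C - 1}" for C i
    using assms(4) that by (simp add: new_vars_def)
  have sub: "var_clause C \<subseteq> var F" if "C \<in> F" for C
    using that by (auto simp: var_def)
  have var_G: "var (G C) \<subseteq> var_clause C \<union> y C ` {2..card C - 1}" if "C \<in> F" for C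
    using var_X1_clause[of "card C" "x C" "y C"] bij_betw_imp_surj_on[OF bij[OF that]]
    by (simp add: G_def var_clause_def)
  have "acyclic_family F G"
  proof (rule acyclic_family_private_vars)
    show "acyclic_family F (\<lambda>C. {C})" using assms(2) by (simp add: acyclic_clause_set_def)
  next
    fix C D v
    assume CD: "C \<in> F" "D \<in> F" "C \<noteq> D" "v \<in> var (G C)" "v \<in> var (G D)"
    \<comment> \<open>A new variable of \<open>C\<close> occurring in \<open>G D\<close> would be
      either a new variable of \<open>D\<close>, against injectivity, or a variable of
      \<open>F\<close>.\<close>
    have "v \<notin> y C ` {2..card C - 1}"
      using CD y_inj[of C D] y_new[of C] var_G[of D] sub[of D] by blast
    then show "v \<in> var {C}" using var_G[of C] CD by (auto simp: var_def)
  qed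
  moreover have "propagation_complete (G C)" if C: "C \<in> F" for C
    unfolding G_def
  proof (rule propagation_complete_X1_clause)
    have cl: "clause C" using assms(1) C by (simp add: clause_set_def)
    have mem: "x C i \<in> C" if "i \<in> {1..card C}" for i
      using bij[OF C] that by (rule bij_betwE[rule_format])
    show "inj_on (\<lambda>i. lvar (x C i)) {1..card C}"
    proof (rule inj_onI)
      fix i j assume ij: "i \<in> {1..card C}" "j \<in> {1..card C}" "lvar (x C i) = lvar (x C j)"
      \<comment> \<open>Two literals of a clause over the same variable coincide, as a clause has no
        complementary pair.\<close>
      then have "x C i = x C j"
        using mem cl unfolding clause_def by (metis lvar_eq_iff)
      then show "i = j" using ij bij_betw_imp_inj_on[OF bij[OF C]] by (simp add: inj_on_eq_iff)
    qed
    show "inj_on (y C) {2..card C - 1}" using y_inj C by (blast intro: inj_onI)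
    show "lvar (x C i) \<noteq> y C j" if "i \<in> {1..card C}" "j \<in> {2..card C - 1}" for i j
    proof -
      have "lvar (x C i) \<in> var F" using mem[OF that(1)] C by (auto simp: var_def var_clause_def)
      then show ?thesis using y_new[OF C that(2)] by metis
    qed
  qed
  ultimately have "propagation_complete (X1 x y F)"
    unfolding X1 using fin finite_var[OF G] by (intro propagation_complete_acyclic_family)
  moreover have "clause_set (X1 x y F)"
    using fin G unfolding X1 by (auto simp: clause_set_def)
  ultimately show ?thesis by (intro PC_if_propagation_complete)
qed

end
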